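(* Let $I=[0,1]$ and let $\mathcal{M}(I)$ be the collection of Lebesgue measurable subsets of $I$. There exists a unique function $\mu$ (called Lebesgue measure) from $\mathcal{M}(I)$ to the non-negative real numbers satisfying all of the following. I. (Length) If $A=(a,b)\subset I$ is an open interval, then $\mu(A)=b-a$. II. (Translation invariance) If $A\in\mathcal{M}(I)$, $c\in\mathbb{R}$ and $A+c\subset I$, where $A+c=\{x+c \mid x\in A\}$, then $\mu(A+c)=\mu(A)$. III. (Countable additivity) If $\{A_n\}_{n=1}^\infty$ is a countable collection of sets in $\mathcal{M}(I)$, then $$\mu\Big(\bigcup_{n=1}^\infty A_n\Big)\le\sum_{n=1}^\infty\mu(A_n),$$ and if the sets $A_n$ are pairwise disjoint, then $$\mu\Big(\bigcup_{n=1}^\infty A_n\Big)=\sum_{n=1}^\infty\mu(A_n).$$ IV. (Monotonicity) If $A,B\in\mathcal{M}(I)$ and $A\subset B$, then $\mu(A)\le\mu(B)$. V. (Null sets) A subset $A\subset I$ is a null set if and only if $A\in\mathcal{M}(I)$ and $\mu(A)=0$.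
   Context: A set $X\subset\mathbb{R}$ is a null set if for every $\epsilon>0$ there is a sequence of open intervals $\{U_n\}_{n=1}^\infty$ (the empty interval $(a,a)$ is allowed) such that $X\subset\bigcup_{n=1}^\infty U_n$ and $\sum_{n=1}^\infty \mathrm{len}(U_n)<\epsilon$, where $\mathrm{len}((a,b))=b-a$. $\mathcal{M}$ denotes the $\sigma$-algebra of subsets of $\mathbb{R}$ generated by the open intervals together with the null sets; its elements are called Lebesgue measurable. $\mathcal{M}(I)$ is the collection of subsets of $I$ that belong to $\mathcal{M}$ (it is a $\sigma$-algebra of subsets of $I$). *)

theory Defs
  imports "HOL-Analysis.Analysis"
begin

text \<open>The lengths are summed in \<^typ>\<open>ennreal\<close>, where a divergent series has the value
  \<open>\<infinity>\<close>; in \<^typ>\<open>real\<close> a divergent \<^const>\<open>suminf\<close> would be unspecified.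
  The choice \<open>a n = b n\<close> gives the empty interval.\<close>

definition null_set :: "real set \<Rightarrow> bool" where
  "null_set X \<longleftrightarrow>
     (\<forall>\<epsilon>>0. \<exists>a b :: nat \<Rightarrow> real.
        (\<forall>n. a n \<le> b n) \<and>
        X \<subseteq> (\<Union>n. {a n<..<b n}) \<and>
        (\<Sum>n. ennreal (b n - a n)) < ennreal \<epsilon>)"

definition lebesgue_measurable_sets :: "real set set" where
  "lebesgue_measurable_sets =
     sigma_sets UNIV ({{a<..<b} | a b. a \<le> b} \<union> {X. null_set X})"

definition lebesgue_measurable_subsets :: "real set \<Rightarrow> real set set" where
  "lebesgue_measurable_subsets I = {A. A \<subseteq> I \<and> A \<in> lebesgue_measurable_sets}"

end

theory Submission
  imports Defs
begin

text \<open>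
  Everything rests on one covering fact (\<open>lebesgue_interval_cover\<close>): a set of finite
  Lebesgue measure can be covered by open intervals whose total length exceeds its measure by as
  little as desired. It holds because the set has an open superset of almost the same measure,
  and an open set of reals of finite measure is a disjoint union of countably many bounded open
  intervals, so that its measure is the sum of their lengths.

  Existence: by the covering fact the null sets in the sense of interval covers are exactly the
  sets in \<^term>\<open>null_sets lebesgue\<close>. Since the Borel sets are generated by the open
  intervals and \<^term>\<open>lebesgue\<close> is the completion of Borel measure, the
  \<open>\<sigma>\<close>-algebra generated by the open intervals and the null sets is the domain of
  \<^term>\<open>lebesgue\<close>. The restriction of \<^term>\<open>measure lebesgue\<close> to the measurable subsets of
  \<open>[0,1]\<close> then has all five properties.

  Uniqueness (\<open>unit_interval_measure_unique\<close>): if \<open>\<nu>\<close> has the properties, cover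
  a measurable set by intervals; subadditivity and the length property give
  \<open>\<nu> A \<le> \<lambda> A\<close>, where \<open>\<lambda>\<close> is Lebesgue measure. The same bound holds for the
  complement \<open>[0,1] - A\<close>, and both measures give \<open>[0,1]\<close> total mass 1, so neither
  inequality can be strict.
\<close>

section \<open>Covering by open intervals\<close>

text \<open>
  The endpoints are the infimum and the supremum: openness excludes them from \<open>K\<close>, and
  connectedness fills the space between them.
\<close>
lemma open_bounded_interval_real:
  fixes K :: "real set"
  assumes "open K" "connected K" "bounded K"
  shows "\<exists>a b. a \<le> b \<and> K = {a<..<b}"
proof (cases "K = {}")
  case True
  then have "K = {0<..<0}"
    by simp
  then show ?thesis
    by blast
next
  case False
  have bdd: "bdd_above K" "bdd_below K"
    using assms(3) by (auto simp: bounded_imp_bdd_above bounded_imp_bdd_below)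
  have "Sup K \<notin> K" "Inf K \<notin> K"
  proof -
    have "\<exists>y\<in>K. x < y" if "x \<in> K" for x
    proof -
      obtain e where "e > 0" "\<And>y. \<bar>y - x\<bar> < e \<Longrightarrow> y \<in> K"
        using assms(1) \<open>x \<in> K\<close> unfolding open_real by blast
      then show ?thesis
        by (intro bexI[of _ "x + e/2"]) auto
    qed
    then show "Sup K \<notin> K"
      using cSup_upper[OF _ bdd(1)] by (meson not_le)
    have "\<exists>y\<in>K. y < x" if "x \<in> K" for x
    proof -
      obtain e where "e > 0" "\<And>y. \<bar>y - x\<bar> < e \<Longrightarrow> y \<in> K"
        using assms(1) \<open>x \<in> K\<close> unfolding open_real by blast
      then show ?thesis
        by (intro bexI[of _ "x - e/2"]) auto
    qed
    then show "Inf K \<notin> K"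
      using cInf_lower[OF _ bdd(2)] by (meson not_le)
  qed
  then have "K \<subseteq> {Inf K<..<Sup K}"
    using cSup_upper[OF _ bdd(1)] cInf_lower[OF _ bdd(2)]
    by (metis greaterThanLessThan_iff order_le_less subsetI)
  moreover have "{Inf K<..<Sup K} \<subseteq> K"
  proof
    fix x assume "x \<in> {Inf K<..<Sup K}"
    then obtain y z where "y \<in> K" "z \<in> K" "y < x" "x < z"
      using False bdd by (auto simp: cInf_less_iff less_cSup_iff)
    then show "x \<in> K"
      using assms(2) unfolding connected_iff_interval by (meson less_imp_le)
  qed
  moreover have "Inf K \<le> Sup K"
    using False bdd by (simp add: cInf_le_cSup)
  ultimately show ?thesis
    by blast
qed

text \<open>
  With any two of its points \<open>K\<close> contains the segment between them, whose length is a lower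
  bound for the measure of \<open>K\<close>; hence the distances in \<open>K\<close> are bounded by its measure.
\<close>
lemma bounded_connected_finite_lborel:
  fixes K :: "real set"
  assumes K: "connected K" "K \<in> sets borel" and fin: "emeasure lborel K < \<infinity>"
  shows "bounded K"
proof (cases "K = {}")
  case False
  then obtain x where x: "x \<in> K"
    by blast
  have "\<bar>y - x\<bar> \<le> measure lborel K" if y: "y \<in> K" for y
  proof -
    have "min x y \<in> K" "max x y \<in> K"
      using x y by (simp_all add: min_def max_def)
    then have "{min x y..max x y} \<subseteq> K"
      using K(1) by (meson connected_contains_Icc)
    then have "measure lborel {min x y..max x y} \<le> measure lborel K"
      using K(2) fin by (intro measure_mono_fmeasurable) (auto simp: fmeasurable_def)
    moreover have "measure lborel {min x y..max x y} = \<bar>y - x\<bar>"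
      by (simp add: min_def max_def)
    ultimately show ?thesis
      by simp
  qed
  then show ?thesis
    unfolding bounded_def dist_real_def by (metis abs_minus_commute)
qed auto

text \<open>
  The intervals are the connected components of \<open>T\<close>: disjoint open sets, hence countably many.
  If there are only finitely many, the enumeration is continued by empty intervals.
\<close>
lemma open_eq_disjoint_open_intervals:
  fixes T :: "real set"
  assumes T: "open T" and fin: "emeasure lborel T < \<infinity>"
  obtains a b :: "nat \<Rightarrow> real" where
    "\<And>n. a n \<le> b n" "T = (\<Union>n. {a n<..<b n})" "disjoint_family (\<lambda>n. {a n<..<b n})"
proof -
  define C where "C = components T"
  have op: "open K" if "K \<in> C" for K
    using T that open_components unfolding C_def by blast
  have C_disj: "pairwise disjnt C"
    using pairwise_disjoint_components[of T] unfolding C_def disjnt_def pairwise_def .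
  have C_countable: "countable C"
    by (rule countable_disjoint_open_subsets[OF op C_disj])
  \<comment> \<open>Outside the range of \<open>to_nat_on C\<close>, \<open>from_nat_into C\<close> repeats a component,
    which would destroy disjointness.\<close>
  define f where "f n = (if n \<in> to_nat_on C ` C then from_nat_into C n else {})" for n
  have f_range: "f n \<in> insert {} C" for n
    by (auto simp: f_def C_countable)
  have "\<Union> (range f) = \<Union> C"
  proof
    show "\<Union> (range f) \<subseteq> \<Union> C"
      using f_range by blast
    have "f (to_nat_on C K) = K" if "K \<in> C" for K
      using that C_countable by (simp add: f_def)
    then show "\<Union> C \<subseteq> \<Union> (range f)"
      by (metis Sup_upper UNIV_I Union_least image_eqI)
  qed
  then have f_Union: "T = (\<Union>n. f n)"
    unfolding C_def by simp
  have f_disj: "disjoint_family f"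
  proof (unfold disjoint_family_on_def, intro ballI impI)
    fix m n :: nat assume "m \<noteq> n"
    show "f m \<inter> f n = {}"
    proof (cases "m \<in> to_nat_on C ` C \<and> n \<in> to_nat_on C ` C")
      case True
      then have "from_nat_into C m \<noteq> from_nat_into C n"
        by (metis \<open>m \<noteq> n\<close> to_nat_on_from_nat_into)
      moreover have "from_nat_into C m \<in> C" "from_nat_into C n \<in> C"
        using True by (auto intro: from_nat_into)
      ultimately show ?thesis
        using True C_disj unfolding f_def pairwise_def disjnt_def by auto
    qed (auto simp: f_def)
  qed
  have "\<exists>a b. a \<le> b \<and> f n = {a<..<b}" for n
  proof (rule open_bounded_interval_real)
    show "open (f n)"
      using f_range[of n] op by auto
    show "connected (f n)"
      using f_range[of n] in_components_connected unfolding C_def by auto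
    moreover have "emeasure lborel (f n) \<le> emeasure lborel T"
      using f_Union T by (intro emeasure_mono) auto
    ultimately show "bounded (f n)"
      using fin \<open>open (f n)\<close>
      by (intro bounded_connected_finite_lborel) auto
  qed
  then obtain a b where ab: "\<And>n. a n \<le> b n" "\<And>n. f n = {a n<..<b n}"
    by metis
  show thesis
    using that[OF ab(1)] f_Union f_disj by (simp flip: ab(2))
qed

lemma lebesgue_interval_cover:
  fixes A :: "real set"
  assumes A: "A \<in> lmeasurable" and e: "e > 0"
  obtains a b :: "nat \<Rightarrow> real" where
    "\<And>n. a n \<le> b n" "A \<subseteq> (\<Union>n. {a n<..<b n})"
    "(\<Sum>n. ennreal (b n - a n)) < emeasure lebesgue A + ennreal e"
proof -
  obtain T where T: "open T" "A \<subseteq> T" "T - A \<in> lmeasurable"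
    "emeasure lebesgue (T - A) < ennreal e"
    using sets_lebesgue_outer_open[OF fmeasurableD[OF A] e] .
  have "emeasure lebesgue T = emeasure lebesgue A + emeasure lebesgue (T - A)"
    using T A by (subst plus_emeasure) (auto simp: fmeasurableD Un_absorb1)
  also have "\<dots> < emeasure lebesgue A + ennreal e"
    using T(4) A by (simp add: ennreal_add_left_cancel_less fmeasurable_def less_top del: emeasure_completion)
  finally have T_less: "emeasure lebesgue T < emeasure lebesgue A + ennreal e" .
  then have "emeasure lborel T < \<infinity>"
    using T(1) by (auto simp: less_top intro: less_le_trans)
  then obtain a b :: "nat \<Rightarrow> real" where ab: "\<And>n. a n \<le> b n" "T = (\<Union>n. {a n<..<b n})"
    "disjoint_family (\<lambda>n. {a n<..<b n})"
    using open_eq_disjoint_open_intervals[OF T(1)] by metis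
  have "(\<Sum>n. ennreal (b n - a n)) = (\<Sum>n. emeasure lborel {a n<..<b n})"
    using ab(1) by simp
  also have "\<dots> = emeasure lborel T"
    unfolding ab(2) by (rule suminf_emeasure) (use ab(3) in auto)
  also have "\<dots> = emeasure lebesgue T"
    using T(1) by simp
  finally show thesis
    using that ab T(2) T_less by metis
qed

section \<open>Null sets and measurable sets\<close>

lemma null_set_iff_null_sets_lebesgue: "null_set X \<longleftrightarrow> X \<in> null_sets lebesgue"
proof
  assume X: "null_set X"
  have "\<exists>T\<in>lmeasurable. X \<subseteq> T \<and> measure lebesgue T < e" if "e > 0" for e
  proof -
    obtain a b :: "nat \<Rightarrow> real" where ab: "\<And>n. a n \<le> b n" "X \<subseteq> (\<Union>n. {a n<..<b n})"
      "(\<Sum>n. ennreal (b n - a n)) < ennreal e"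
      using X \<open>e > 0\<close> unfolding null_set_def by metis
    let ?T = "\<Union>n. {a n<..<b n}"
    have "emeasure lebesgue ?T \<le> (\<Sum>n. emeasure lebesgue {a n<..<b n})"
      by (rule emeasure_subadditive_countably) auto
    also have "\<dots> = (\<Sum>n. ennreal (b n - a n))"
      using ab(1) by simp
    finally have less: "emeasure lebesgue ?T < ennreal e"
      using ab(3) by (rule le_less_trans)
    have T: "?T \<in> lmeasurable"
      using less by (intro fmeasurableI) (auto intro: less_trans)
    then have "ennreal (measure lebesgue ?T) < ennreal e"
      using less by (simp add: emeasure_eq_measure2)
    then have "measure lebesgue ?T < e"
      by (simp add: ennreal_less_iff)
    with T ab(2) show ?thesis
      by blast
  qed
  then show "X \<in> null_sets lebesgue"
    by (simp add: completion.null_sets_outer)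
next
  assume X: "X \<in> null_sets lebesgue"
  show "null_set X"
    unfolding null_set_def
  proof (intro allI impI)
    fix e :: real assume "e > 0"
    obtain a b :: "nat \<Rightarrow> real" where "\<And>n. a n \<le> b n" "X \<subseteq> (\<Union>n. {a n<..<b n})"
      "(\<Sum>n. ennreal (b n - a n)) < emeasure lebesgue X + ennreal e"
      using lebesgue_interval_cover[OF fmeasurableI_null_sets[OF X] \<open>e > 0\<close>] by metis
    moreover have "emeasure lebesgue X = 0"
      using X by (rule null_setsD1)
    ultimately show "\<exists>a b. (\<forall>n. a n \<le> b n) \<and> X \<subseteq> (\<Union>n. {a n<..<b n}) \<and>
        (\<Sum>n. ennreal (b n - a n)) < ennreal e"
      by (metis add_0)
  qed
qed

text \<open>
  A set in the completion is a Borel set together with a subset of a Borel null set. The first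
  part is generated by open intervals, the second is a null set.
\<close>
lemma lebesgue_measurable_sets_eq: "lebesgue_measurable_sets = sets lebesgue"
proof
  let ?G = "{{a<..<b} | a b. a \<le> b} \<union> {X. null_set X}"
  have "?G \<subseteq> sets lebesgue"
    by (auto simp: null_set_iff_null_sets_lebesgue)
  then show "lebesgue_measurable_sets \<subseteq> sets lebesgue"
    unfolding lebesgue_measurable_sets_def
    using sets.sigma_sets_subset[of ?G lebesgue] by simp
next
  interpret G: sigma_algebra UNIV "lebesgue_measurable_sets"
    unfolding lebesgue_measurable_sets_def by (rule sigma_algebra_sigma_sets) auto
  have null: "N \<in> lebesgue_measurable_sets" if "null_set N" for N
    unfolding lebesgue_measurable_sets_def using that by (auto intro: sigma_sets.Basic)
  have "box a b \<in> lebesgue_measurable_sets" for a b :: real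
  proof (cases "a \<le> b")
    case True
    then show ?thesis
      unfolding lebesgue_measurable_sets_def box_real by (auto intro!: sigma_sets.Basic)
  qed (auto simp: box_real)
  then have "sigma_sets UNIV (range (\<lambda>(a, b). box a b :: real set)) \<subseteq> lebesgue_measurable_sets"
    by (intro G.sigma_sets_subset) auto
  then have borel: "sets borel \<subseteq> lebesgue_measurable_sets"
    by (subst borel_eq_box) (simp del: box_real)
  show "sets lebesgue \<subseteq> lebesgue_measurable_sets"
  proof
    fix A :: "real set" assume "A \<in> sets lebesgue"
    then obtain S N N' where A: "A = S \<union> N" "N \<subseteq> N'" "N' \<in> null_sets lborel" "S \<in> sets lborel"
      by (auto elim: completionE simp: sets_completion)
    then have "null_set N"
      by (auto simp: null_set_iff_null_sets_lebesgue null_sets_completion_iff2)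
    then show "A \<in> lebesgue_measurable_sets"
      using A borel null by auto
  qed
qed

section \<open>Uniqueness\<close>

lemma unit_interval_measure_unique:
  fixes \<nu> :: "real set \<Rightarrow> real"
  defines "M \<equiv> {A. A \<subseteq> {0..1} \<and> A \<in> sets lebesgue}"
  assumes nonneg: "\<And>A. A \<in> M \<Longrightarrow> 0 \<le> \<nu> A"
    and length: "\<And>a b. a \<le> b \<Longrightarrow> {a<..<b} \<subseteq> {0..1} \<Longrightarrow> \<nu> {a<..<b} = b - a"
    and subadditive: "\<And>A :: nat \<Rightarrow> real set. (\<And>n. A n \<in> M) \<Longrightarrow>
          ennreal (\<nu> (\<Union>n. A n)) \<le> (\<Sum>n. ennreal (\<nu> (A n)))"
    and additive: "\<And>A :: nat \<Rightarrow> real set. (\<And>n. A n \<in> M) \<Longrightarrow> disjoint_family A \<Longrightarrow>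
          ennreal (\<nu> (\<Union>n. A n)) = (\<Sum>n. ennreal (\<nu> (A n)))"
    and mono: "\<And>A B. A \<in> M \<Longrightarrow> B \<in> M \<Longrightarrow> A \<subseteq> B \<Longrightarrow> \<nu> A \<le> \<nu> B"
    and null: "\<And>A. A \<subseteq> {0..1} \<Longrightarrow> A \<in> null_sets lebesgue \<Longrightarrow> \<nu> A = 0"
    and A: "A \<in> M"
  shows "\<nu> A = measure lebesgue A"
proof -
  have empty: "\<nu> {} = 0"
    by (rule null) auto
  have union_eq: "\<nu> (A \<union> B) = \<nu> A + \<nu> B" if "A \<in> M" "B \<in> M" "A \<inter> B = {}" for A B
  proof -
    have "ennreal (\<nu> (\<Union>n. binaryset A B n)) = (\<Sum>n. ennreal (\<nu> (binaryset A B n)))"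
      using that by (intro additive) (auto simp: binaryset_def M_def disjoint_family_on_def)
    also have "\<dots> = ennreal (\<nu> A) + ennreal (\<nu> B)"
      using empty by (intro suminf_binaryset_eq) auto
    finally have "ennreal (\<nu> (A \<union> B)) = ennreal (\<nu> A + \<nu> B)"
      using that nonneg by (simp add: UN_binaryset_eq)
    moreover have "A \<union> B \<in> M"
      using that by (auto simp: M_def)
    ultimately show ?thesis
      using that nonneg by (subst (asm) ennreal_inj) auto
  qed
  \<comment> \<open>An interval cut down to \<open>[0,1]\<close> may contain an endpoint of \<open>[0,1]\<close>, which the
    length property does not cover; as a null set it contributes nothing.\<close>
  have endpoints: "{0, 1} \<in> M" "\<nu> {0, 1} = 0"
    by (auto simp: M_def intro!: null finite_imp_null_set_lborel null_sets_completionI)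
  have interval: "\<nu> ({a<..<b} \<inter> {0..1}) \<le> b - a" if "a \<le> b" for a b
  proof -
    \<comment> \<open>The outer \<open>max\<close> in \<open>d\<close> makes the interval empty, rather than reversed, when
      \<open>(a,b)\<close> lies outside \<open>[0,1]\<close>.\<close>
    define c where "c = max 0 a"
    define d where "d = max c (min 1 b)"
    have "c \<le> d" and sub: "{c<..<d} \<subseteq> {0..1}" and cover: "{a<..<b} \<inter> {0..1} \<subseteq> {c<..<d} \<union> {0, 1}"
      by (auto simp: c_def d_def)
    have "d - c \<le> b - a"
      using \<open>a \<le> b\<close> by (auto simp: c_def d_def)
    have cd: "{c<..<d} \<in> M"
      using sub by (auto simp: M_def)
    have "\<nu> ({a<..<b} \<inter> {0..1}) \<le> \<nu> ({c<..<d} \<union> {0, 1})"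
      using cover sub by (intro mono) (auto simp: M_def)
    also have "\<dots> = \<nu> {c<..<d} + \<nu> {0, 1}"
      using cd endpoints by (intro union_eq) (auto simp: c_def d_def)
    also have "\<dots> = d - c"
      using length[OF \<open>c \<le> d\<close> sub] endpoints by simp
    finally show ?thesis
      using \<open>d - c \<le> b - a\<close> by linarith
  qed
  have lmeas: "B \<in> lmeasurable" if "B \<in> M" for B
    using that fmeasurable_compact[of "{0..1::real}"] by (auto simp: M_def intro: fmeasurableI2)
  have upper: "\<nu> B \<le> measure lebesgue B" if B: "B \<in> M" for B
  proof (rule field_le_epsilon)
    fix e :: real assume "e > 0"
    obtain a b :: "nat \<Rightarrow> real" where ab: "\<And>n. a n \<le> b n" "B \<subseteq> (\<Union>n. {a n<..<b n})"
      "(\<Sum>n. ennreal (b n - a n)) < emeasure lebesgue B + ennreal e"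
      using lebesgue_interval_cover[OF lmeas[OF B] \<open>e > 0\<close>] by metis
    let ?U = "\<lambda>n. {a n<..<b n} \<inter> {0..1}"
    have U: "?U n \<in> M" for n
      by (auto simp: M_def)
    have "\<nu> B \<le> \<nu> (\<Union>n. ?U n)"
      using B ab(2) by (intro mono) (auto simp: M_def)
    then have "ennreal (\<nu> B) \<le> ennreal (\<nu> (\<Union>n. ?U n))"
      by (rule ennreal_leI)
    also have "\<dots> \<le> (\<Sum>n. ennreal (\<nu> (?U n)))"
      by (rule subadditive[OF U])
    also have "\<dots> \<le> (\<Sum>n. ennreal (b n - a n))"
      using interval[OF ab(1)] by (intro suminf_le ennreal_leI) auto
    also have "\<dots> \<le> ennreal (measure lebesgue B + e)"
      using ab(3) \<open>e > 0\<close> lmeas[OF B] by (simp add: emeasure_eq_measure2)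
    finally show "\<nu> B \<le> measure lebesgue B + e"
      using \<open>e > 0\<close> by (subst (asm) ennreal_le_iff) auto
  qed
  \<comment> \<open>The upper bounds for \<open>A\<close> and its complement add up to 1, while the two values of
    \<open>\<nu>\<close> add up to at least \<open>\<nu> (0,1) = 1\<close>; so both bounds are attained.\<close>
  let ?A' = "{0..1} - A"
  have A': "?A' \<in> M" and "{0<..<1} \<in> M"
    using A by (auto simp: M_def)
  have "1 \<le> \<nu> (A \<union> ?A')"
    using mono[of "{0<..<1}" "A \<union> ?A'"] length[of 0 1] A by (force simp: M_def)
  also have "\<dots> = \<nu> A + \<nu> ?A'"
    using A A' by (intro union_eq) auto
  finally have "1 \<le> \<nu> A + \<nu> ?A'" .
  moreover have "measure lebesgue ?A' = 1 - measure lebesgue A"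
    using measurable_measure_Diff[of "{0..1}" lebesgue A] A by (auto simp: M_def)
  ultimately show ?thesis
    using upper[OF A] upper[OF A'] by linarith
qed

section \<open>Existence and uniqueness of Lebesgue measure on the unit interval\<close>

theorem theorem2p4p2:
  fixes I :: "real set" and M :: "real set set"
  defines "I \<equiv> {0..1}"
  defines "M \<equiv> lebesgue_measurable_subsets I"
  shows "\<exists>!\<mu>. \<mu> \<in> M \<rightarrow>\<^sub>E {0::real..} \<and>
    (\<forall>a b. a \<le> b \<and> {a<..<b} \<subseteq> I \<longrightarrow> \<mu> {a<..<b} = b - a) \<and>
    (\<forall>A\<in>M. \<forall>c. (\<lambda>x. x + c) ` A \<subseteq> I \<longrightarrow> \<mu> ((\<lambda>x. x + c) ` A) = \<mu> A) \<and>
    (\<forall>A :: nat \<Rightarrow> real set. (\<forall>n. A n \<in> M) \<longrightarrow>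
       ennreal (\<mu> (\<Union>n. A n)) \<le> (\<Sum>n. ennreal (\<mu> (A n))) \<and>
       (disjoint_family A \<longrightarrow> ennreal (\<mu> (\<Union>n. A n)) = (\<Sum>n. ennreal (\<mu> (A n))))) \<and>
    (\<forall>A\<in>M. \<forall>B\<in>M. A \<subseteq> B \<longrightarrow> \<mu> A \<le> \<mu> B) \<and>
    (\<forall>A. A \<subseteq> I \<longrightarrow> (null_set A \<longleftrightarrow> A \<in> M \<and> \<mu> A = 0))"
    (is "\<exists>!\<mu>. ?P \<mu>")
proof -
  have M_eq: "M = {A. A \<subseteq> {0..1} \<and> A \<in> sets lebesgue}"
    unfolding M_def I_def lebesgue_measurable_subsets_def lebesgue_measurable_sets_eq ..
  have lmeas: "A \<in> lmeasurable" if "A \<in> M" for A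
    using that fmeasurable_compact[of "{0..1::real}"] by (auto simp: M_eq intro: fmeasurableI2)
  define \<mu> where "\<mu> = restrict (measure lebesgue) M"
  have \<mu>: "\<mu> A = measure lebesgue A" if "A \<in> M" for A
    using that by (simp add: \<mu>_def)
  have \<mu>_emeasure: "ennreal (\<mu> A) = emeasure lebesgue A" if "A \<in> M" for A
    using that lmeas by (simp add: \<mu> emeasure_eq_measure2)
  have "?P \<mu>"
  proof (intro conjI allI ballI impI)
    show "\<mu> \<in> M \<rightarrow>\<^sub>E {0..}"
      by (auto simp: \<mu>_def)
  next
    fix a b :: real assume "a \<le> b \<and> {a<..<b} \<subseteq> I"
    then show "\<mu> {a<..<b} = b - a"
      by (subst \<mu>) (auto simp: M_eq I_def)
  next
    fix A c assume A: "A \<in> M" and sub: "(\<lambda>x. x + c) ` A \<subseteq> I"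
    have eq: "(\<lambda>x. x + c) ` A = (+) c ` A"
      by (simp add: add.commute)
    have "(\<lambda>x. x + c) ` A \<in> M"
      using A sub lebesgue_sets_translation[of A c] by (simp add: eq M_eq I_def)
    then show "\<mu> ((\<lambda>x. x + c) ` A) = \<mu> A"
      using A by (simp add: \<mu> eq measure_translation)
  next
    fix A :: "nat \<Rightarrow> real set" assume A: "\<forall>n. A n \<in> M"
    then have U: "(\<Union>n. A n) \<in> M" and sets: "range A \<subseteq> sets lebesgue"
      by (auto simp: M_eq)
    show "ennreal (\<mu> (\<Union>n. A n)) \<le> (\<Sum>n. ennreal (\<mu> (A n)))"
      using A U sets by (simp add: \<mu>_emeasure emeasure_subadditive_countably del: emeasure_completion)
    assume "disjoint_family A"
    then show "ennreal (\<mu> (\<Union>n. A n)) = (\<Sum>n. ennreal (\<mu> (A n)))"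
      using A U sets by (simp add: \<mu>_emeasure suminf_emeasure del: emeasure_completion)
  next
    fix A B assume "A \<in> M" "B \<in> M" "A \<subseteq> B"
    then show "\<mu> A \<le> \<mu> B"
      using lmeas by (simp add: \<mu> measure_mono_fmeasurable fmeasurableD)
  next
    fix A assume "A \<subseteq> I"
    then have "null_set A \<longleftrightarrow> A \<in> M \<and> emeasure lebesgue A = 0"
      by (auto simp: null_set_iff_null_sets_lebesgue null_sets_def M_eq I_def)
    also have "\<dots> \<longleftrightarrow> A \<in> M \<and> \<mu> A = 0"
      using lmeas by (auto simp: \<mu> emeasure_eq_measure2)
    finally show "null_set A \<longleftrightarrow> A \<in> M \<and> \<mu> A = 0" .
  qed
  moreover have "\<nu> = \<mu>" if \<nu>: "?P \<nu>" for \<nu>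
  proof (rule PiE_ext)
    show "\<nu> \<in> M \<rightarrow>\<^sub>E {0..}" "\<mu> \<in> M \<rightarrow>\<^sub>E {0..}"
      using conjunct1[OF \<nu>] conjunct1[OF \<open>?P \<mu>\<close>] .
    fix A assume A: "A \<in> M"
    have length: "\<forall>a b. a \<le> b \<and> {a<..<b} \<subseteq> I \<longrightarrow> \<nu> {a<..<b} = b - a"
      and additive: "\<forall>A :: nat \<Rightarrow> real set. (\<forall>n. A n \<in> M) \<longrightarrow>
        ennreal (\<nu> (\<Union>n. A n)) \<le> (\<Sum>n. ennreal (\<nu> (A n))) \<and>
        (disjoint_family A \<longrightarrow> ennreal (\<nu> (\<Union>n. A n)) = (\<Sum>n. ennreal (\<nu> (A n))))"
      and mono: "\<forall>A\<in>M. \<forall>B\<in>M. A \<subseteq> B \<longrightarrow> \<nu> A \<le> \<nu> B"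
      and null: "\<forall>A. A \<subseteq> I \<longrightarrow> (null_set A \<longleftrightarrow> A \<in> M \<and> \<nu> A = 0)"
      using \<nu> by - (elim conjE, assumption)+
    have "\<nu> A = measure lebesgue A"
    proof (rule unit_interval_measure_unique[folded M_eq I_def])
      show "A \<in> M"
        by (rule A)
    next
      show "0 \<le> \<nu> A" if "A \<in> M" for A
        using PiE_mem[OF conjunct1[OF \<nu>] that] by simp
    next
      show "\<nu> A = 0" if "A \<subseteq> I" "A \<in> null_sets lebesgue" for A
        using null that by (simp add: null_set_iff_null_sets_lebesgue)
    qed (use length additive mono in blast)+
    then show "\<nu> A = \<mu> A"
      using A by (simp add: \<mu>)
  qed
  ultimately show ?thesis
    by (rule ex1I)
qed

end
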